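(* Let $F,f,g$ satisfy the Standing Assumption, assume $\nabla F$ is Lipschitz continuous on bounded sets, and let $\{z^k\}=\{(W^k,H^k)\}$ be generated by the accPALM scheme from $z^0$ and be bounded. Let $\omega(z^0)$ be its set of limit points, suppose $J\equiv J^*$ on $\omega(z^0)$, and suppose $J$ has the KL property at the points of $\omega(z^0)$ with desingularizing function $\varphi(t)=\frac{c}{\theta}t^{\theta}$, where $\theta\in(0,1]$ and $c>0$. Let $r_k=J(z^k)-J^*$. Then there is $k_2$ such that for all $k\ge k_2$: (1) if $\theta=1$, then $r_k=0$ after finitely many steps; (2) if $\theta\in[\tfrac12,1)$, then there exists $P\in[0,1)$ with $r_k\le r_{k_2}P^{\,k-k_2}$; (3) if $\theta\in(0,\tfrac12)$, then there exists $Q>0$ with $r_k\le\Big(\frac{Q}{(k-k_2)(1-2\theta)}\Big)^{\frac{1}{1-2\theta}}$ for $k>k_2$.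
   Context: Setting. Let $p,r,n$ be positive integers. For matrices, $\|\cdot\|$ denotes the Frobenius norm, and for pairs $\|(A,B)\|=(\|A\|^2+\|B\|^2)^{1/2}$. Consider $J(W,H)=F(W,H)+f(W)+g(H)$ with $W\in\mathbb R^{p\times r}$, $H\in\mathbb R^{r\times n}$. $\partial$ denotes the limiting subdifferential. KL property at $\bar z$ with desingularizing function $\varphi$: there exist $\eta>0$ and a neighborhood $U$ of $\bar z$ such that $\varphi'(J(z)-J(\bar z))\operatorname{dist}(0,\partial J(z))\ge1$ for all $z\in U$ with $J(\bar z)<J(z)<J(\bar z)+\eta$. Standing Assumption: (a) $f:\mathbb R^{p\times r}\to(-\infty,+\infty]$ and $g:\mathbb R^{r\times n}\to(-\infty,+\infty]$ are proper and lower semicontinuous; (b) $\inf J>-\infty$, $\inf f>-\infty$, $\inf g>-\infty$; (c) $F$ is $C^1$; for every fixed $H$, $W\mapsto\nabla_W F(W,H)$ is Lipschitz with constant $L_W$ (independent of $H$), and for every fixed $W$, $H\mapsto \nabla_H F(W,H)$ is Lipschitz with constant $L_H$ (independent of $W$). Proximal map: for a proper lsc $\sigma$ and $t>0$, $\operatorname{prox}^\sigma_t(x)=\operatorname{argmin}_u\{\sigma(u)+\tfrac t2\|u-x\|^2\}$ (any element may be chosen). accPALM scheme. Fix $\rho_0>0$ and $\beta_{\max}\in[0,1)$. Start from $(W^0,H^0)$ with $f(W^0),g(H^0)<\infty$ and set $(W^{-1},H^{-1})=(W^0,H^0)$. At iteration $k\ge0$: pick $\beta_k\in[0,\beta_{\max}]$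 and step sizes $c_k,d_k$ with $L_W+2\rho_0\le c_k\le \bar c$, $L_H+2\rho_0\le d_k\le\bar d$ for fixed constants $\bar c,\bar d$. Form $\widehat W=W^k+\beta_k(W^k-W^{k-1})$, $\widehat H=H^k+\beta_k(H^k-H^{k-1})$, and compute $W'\in\operatorname{prox}^f_{c_k}(\widehat W-\tfrac1{c_k}\nabla_W F(\widehat W,\widehat H))$, $H'\in\operatorname{prox}^g_{d_k}(\widehat H-\tfrac1{d_k}\nabla_H F(W',\widehat H))$. If $J(W',H')\le J(W^k,H^k)-\rho_0\|(W'-\widehat W,H'-\widehat H)\|^2$, set $(W^{k+1},H^{k+1})=(W',H')$. Otherwise compute $W^{k+1}\in\operatorname{prox}^f_{c_k}(W^k-\tfrac1{c_k}\nabla_W F(W^k,H^k))$, $H^{k+1}\in\operatorname{prox}^g_{d_k}(H^k-\tfrac1{d_k}\nabla_H F(W^{k+1},H^k))$. Notation: $z^k=(W^k,H^k)$. *)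

theory Defs
  imports "HOL-Analysis.Analysis" "HOL-Library.Extended_Real"
begin

(* Extended-real valued functions model functions with values in (-inf,+inf]. *)

definition proper_fun :: "('a \<Rightarrow> ereal) \<Rightarrow> bool" where
  "proper_fun f \<longleftrightarrow> (\<forall>x. f x \<noteq> -\<infinity>) \<and> (\<exists>x. f x \<noteq> \<infinity>)"

(* sequential lower semicontinuity (equivalent to topological lsc on metric spaces) *)
definition lsc_fun :: "('a::metric_space \<Rightarrow> ereal) \<Rightarrow> bool" where
  "lsc_fun f \<longleftrightarrow> (\<forall>x xs. xs \<longlonglongrightarrow> x \<longrightarrow> f x \<le> liminf (\<lambda>k. f (xs k)))"

(* Frechet (regular) subdifferential: v such that
   liminf_{y->x, y<>x} (J y - J x - <v,y-x>)/|y-x| >= 0, written in epsilon-delta form *)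
definition frechet_subdiff :: "('a::real_inner \<Rightarrow> ereal) \<Rightarrow> 'a \<Rightarrow> 'a set" where
  "frechet_subdiff J x = {v. \<bar>J x\<bar> \<noteq> \<infinity> \<and>
     (\<forall>\<epsilon>>0. \<exists>\<delta>>0. \<forall>y. norm (y - x) < \<delta> \<longrightarrow>
        J x + ereal (inner v (y - x) - \<epsilon> * norm (y - x)) \<le> J y)}"

definition limiting_subdiff :: "('a::real_inner \<Rightarrow> ereal) \<Rightarrow> 'a \<Rightarrow> 'a set" where
  "limiting_subdiff J x = {v. \<exists>xs vs. xs \<longlonglongrightarrow> x \<and> (\<lambda>k. J (xs k)) \<longlonglongrightarrow> J x \<and>
       vs \<longlonglongrightarrow> v \<and> (\<forall>k. vs k \<in> frechet_subdiff J (xs k))}"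

(* dist(0, S) = inf of norms, +inf for the empty set *)
definition dist0 :: "'a::real_normed_vector set \<Rightarrow> ereal" where
  "dist0 S = (INF v\<in>S. ereal (norm v))"

definition KL_at :: "('a::real_inner \<Rightarrow> ereal) \<Rightarrow> 'a \<Rightarrow> (real \<Rightarrow> real) \<Rightarrow> bool" where
  "KL_at J zbar phi \<longleftrightarrow> (\<exists>\<eta>>0. \<exists>U. open U \<and> zbar \<in> U \<and>
     (\<forall>z\<in>U. J zbar < J z \<and> J z < J zbar + ereal \<eta> \<longrightarrow>
        ereal (deriv phi (real_of_ereal (J z - J zbar))) * dist0 (limiting_subdiff J z) \<ge> 1))"

definition is_prox :: "('a::real_normed_vector \<Rightarrow> ereal) \<Rightarrow> real \<Rightarrow> 'a \<Rightarrow> 'a \<Rightarrow> bool" where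
  "is_prox \<sigma> t x u \<longleftrightarrow>
     (\<forall>v. \<sigma> u + ereal (t / 2 * (norm (u - x))\<^sup>2) \<le> \<sigma> v + ereal (t / 2 * (norm (v - x))\<^sup>2))"

definition Jfun :: "('w \<times> 'h \<Rightarrow> real) \<Rightarrow> ('w \<Rightarrow> ereal) \<Rightarrow> ('h \<Rightarrow> ereal) \<Rightarrow> 'w \<times> 'h \<Rightarrow> ereal" where
  "Jfun F f g z = ereal (F z) + f (fst z) + g (snd z)"

(* accPALM: z is a sequence generated by the scheme with parameters rho0, beta, c, d;
   grad is the gradient of F; (W^{-1},H^{-1}) = (W^0,H^0) is encoded via z (k-1) with
   natural-number subtraction (so z (0-1) = z 0). *)
definition accPALM ::
  "('w::real_normed_vector \<times> 'h::real_normed_vector \<Rightarrow> real) \<Rightarrow> ('w \<times> 'h \<Rightarrow> 'w \<times> 'h) \<Rightarrow>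
   ('w \<Rightarrow> ereal) \<Rightarrow> ('h \<Rightarrow> ereal) \<Rightarrow> real \<Rightarrow> (nat \<Rightarrow> real) \<Rightarrow> (nat \<Rightarrow> real) \<Rightarrow> (nat \<Rightarrow> real) \<Rightarrow>
   (nat \<Rightarrow> 'w \<times> 'h) \<Rightarrow> bool" where
  "accPALM F grad f g \<rho>0 \<beta> c d z \<longleftrightarrow>
    (\<forall>k. let Wk = fst (z k); Hk = snd (z k);
             Wp = fst (z (k - 1)); Hp = snd (z (k - 1));
             Wh = Wk + \<beta> k *\<^sub>R (Wk - Wp); Hh = Hk + \<beta> k *\<^sub>R (Hk - Hp)
         in \<exists>W' H'.
              is_prox f (c k) (Wh - (1 / c k) *\<^sub>R fst (grad (Wh, Hh))) W' \<and>
              is_prox g (d k) (Hh - (1 / d k) *\<^sub>R snd (grad (W', Hh))) H' \<and>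
              (if Jfun F f g (W', H') \<le> Jfun F f g (z k) - ereal (\<rho>0 * (norm (W' - Wh, H' - Hh))\<^sup>2)
               then z (Suc k) = (W', H')
               else is_prox f (c k) (Wk - (1 / c k) *\<^sub>R fst (grad (Wk, Hk))) (fst (z (Suc k))) \<and>
                    is_prox g (d k) (Hk - (1 / d k) *\<^sub>R snd (grad (fst (z (Suc k)), Hk))) (snd (z (Suc k)))))"

end

theory Submission
  imports Defs
begin

text \<open>
  Let \<open>y k\<close> be the point from which the accepted step \<open>k\<close> is taken: the extrapolated point, or
  \<open>z k\<close> itself after a rejection. In both cases \<open>J (z (Suc k)) \<le> J (z k) - \<rho> \<parallel>z (Suc k) - y k\<parallel>\<^sup>2\<close>,
  and the optimality conditions of the two proximal steps yield a subgradient of \<open>J\<close> at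
  \<open>z (Suc k)\<close> of norm at most \<open>C \<parallel>z (Suc k) - y k\<parallel>\<close>. The same steps show \<open>J (z k) \<longlonglongrightarrow> J\<^sup>*\<close>, so the
  KL inequality is eventually available along the sequence and gives
  \<open>r (k + 1) powr (2 (1 - \<theta>)) \<le> K (r k - r (k + 1))\<close> for \<open>r k = J (z k) - J\<^sup>*\<close>. All three rates
  follow from this recursion.
\<close>

section \<open>Quadratic bounds for smooth functions and proximal steps\<close>

text \<open>On the segment from \<open>x\<close> to \<open>y\<close>, subtracting the linear and
  quadratic terms from \<open>G\<close> leaves a function \<open>h\<close> of one variable. Its
  derivative \<open>h'\<close> is nonpositive on the unit interval by Cauchy-Schwarz and the
  Lipschitz bound, and the claim is \<open>h 1 \<le> h 0\<close>.\<close>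

lemma descent_lemma:
  fixes G :: "'a::real_inner \<Rightarrow> real" and D :: "'a \<Rightarrow> 'a"
  assumes deriv: "\<And>x. (G has_derivative (\<lambda>h. inner (D x) h)) (at x)"
    and lip: "\<And>x y. norm (D x - D y) \<le> L * norm (x - y)"
  shows "G y \<le> G x + inner (D x) (y - x) + L / 2 * (norm (y - x))\<^sup>2"
proof -
  define h where "h t = G (x + t *\<^sub>R (y - x)) - t * inner (D x) (y - x)
      - L / 2 * t\<^sup>2 * (norm (y - x))\<^sup>2" for t :: real
  define h' where "h' t = inner (D (x + t *\<^sub>R (y - x)) - D x) (y - x) - L * t * (norm (y - x))\<^sup>2"
    for t :: real
  have h_deriv: "(h has_real_derivative h' t) (at t)" for t
  proof -
    have "((\<lambda>t. x + t *\<^sub>R (y - x)) has_derivative (\<lambda>s. s *\<^sub>R (y - x))) (at t)"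
      by (auto intro!: derivative_eq_intros)
    from has_derivative_compose[OF this deriv]
    have "((\<lambda>t. G (x + t *\<^sub>R (y - x))) has_real_derivative
        inner (D (x + t *\<^sub>R (y - x))) (y - x)) (at t)"
      unfolding has_field_derivative_def by (simp add: mult_commute_abs)
    then show ?thesis
      unfolding h_def[abs_def] h'_def
      by (auto intro!: derivative_eq_intros simp: inner_diff_left)
  qed
  have "h 1 \<le> h 0"
  proof (rule DERIV_nonpos_imp_nonincreasing[of 0 1 h])
    fix t :: real assume t: "0 \<le> t" "t \<le> 1"
    have "inner (D (x + t *\<^sub>R (y - x)) - D x) (y - x)
        \<le> norm (D (x + t *\<^sub>R (y - x)) - D x) * norm (y - x)"
      by (rule norm_cauchy_schwarz)
    also have "\<dots> \<le> (L * norm (t *\<^sub>R (y - x))) * norm (y - x)"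
      using lip[of "x + t *\<^sub>R (y - x)" x] by (intro mult_right_mono) auto
    also have "\<dots> = L * t * (norm (y - x))\<^sup>2"
      using t by (simp add: power2_eq_square)
    finally have "h' t \<le> 0" by (simp add: h'_def)
    with h_deriv show "\<exists>y. (h has_real_derivative y) (at t) \<and> y \<le> 0" by blast
  qed simp
  then show ?thesis by (simp add: h_def)
qed

text \<open>Completing the square about the shifted centre leaves
  \<open>(norm G)\<^sup>2 / (2 * t)\<close>, which is the same for every competitor and cancels.
  What remains compares linearized models.\<close>

lemma is_prox_gradient_step:
  fixes \<sigma> :: "'a::real_inner \<Rightarrow> ereal"
  assumes "is_prox \<sigma> t (x - (1 / t) *\<^sub>R G) u" and "t > 0"
  shows "\<sigma> u + ereal (inner G (u - x) + t / 2 * (norm (u - x))\<^sup>2)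
    \<le> \<sigma> v + ereal (inner G (v - x) + t / 2 * (norm (v - x))\<^sup>2)"
proof -
  have *: "t / 2 * (norm (w - (x - (1 / t) *\<^sub>R G)))\<^sup>2
      = inner G (w - x) + t / 2 * (norm (w - x))\<^sup>2 + (norm G)\<^sup>2 / (2 * t)" for w
  proof -
    have "w - (x - (1 / t) *\<^sub>R G) = (w - x) + (1 / t) *\<^sub>R G" by simp
    then show ?thesis
      using \<open>t > 0\<close>
      by (simp only: power2_norm_eq_inner inner_add_left inner_add_right)
        (simp add: field_simps inner_commute)
  qed
  from assms(1) have "\<sigma> u + ereal (inner G (u - x) + t / 2 * (norm (u - x))\<^sup>2 + (norm G)\<^sup>2 / (2 * t))
    \<le> \<sigma> v + ereal (inner G (v - x) + t / 2 * (norm (v - x))\<^sup>2 + (norm G)\<^sup>2 / (2 * t))"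
    unfolding is_prox_def * by blast
  then show ?thesis
    by (cases "\<sigma> u"; cases "\<sigma> v") auto
qed

lemma is_prox_finite:
  assumes "proper_fun \<sigma>" "is_prox \<sigma> t x u"
  shows "\<bar>\<sigma> u\<bar> \<noteq> \<infinity>"
proof -
  obtain v where v: "\<sigma> v \<noteq> \<infinity>" and u: "\<sigma> u \<noteq> -\<infinity>"
    using assms(1) by (auto simp: proper_fun_def)
  have "\<sigma> u + ereal (t / 2 * (norm (u - x))\<^sup>2) \<le> \<sigma> v + ereal (t / 2 * (norm (v - x))\<^sup>2)"
    using assms(2) by (auto simp: is_prox_def)
  with u v show ?thesis by (cases "\<sigma> u"; cases "\<sigma> v") auto
qed

text \<open>This is the optimality condition of the step in the form of a global quadratic minorant.
  It needs no convexity of \<sigma>, only an expansion of the square about \<open>u\<close>.\<close>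

lemma is_prox_proximal_subgradient:
  fixes \<sigma> :: "'a::real_inner \<Rightarrow> ereal"
  assumes "is_prox \<sigma> t (x - (1 / t) *\<^sub>R G) u" and "t > 0"
  shows "\<sigma> u + ereal (inner (- G - t *\<^sub>R (u - x)) (v - u) - t / 2 * (norm (v - u))\<^sup>2) \<le> \<sigma> v"
proof -
  have "(norm (v - x))\<^sup>2 = (norm (v - u))\<^sup>2 + 2 * inner (u - x) (v - u) + (norm (u - x))\<^sup>2"
  proof -
    have "v - x = (v - u) + (u - x)" by simp
    then show ?thesis
      by (simp only: power2_norm_eq_inner inner_add_left inner_add_right)
        (simp add: inner_commute)
  qed
  moreover have "inner G (v - x) = inner G (v - u) + inner G (u - x)"
    by (simp add: inner_diff_right)
  moreover have "inner (- G - t *\<^sub>R (u - x)) (v - u) = - inner G (v - u) - t * inner (u - x) (v - u)"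
    by (simp only: inner_diff_left[of "- G"] inner_minus_left inner_scaleR_left)
  ultimately have "inner G (u - x) + t / 2 * (norm (u - x))\<^sup>2
      - (inner G (v - x) + t / 2 * (norm (v - x))\<^sup>2)
    = inner (- G - t *\<^sub>R (u - x)) (v - u) - t / 2 * (norm (v - u))\<^sup>2"
    by (simp only:) (simp add: field_simps)
  with is_prox_gradient_step[OF assms, of v] show ?thesis
    by (cases "\<sigma> u"; cases "\<sigma> v") auto
qed

section \<open>Subgradients of the composite objective\<close>

text \<open>Because \<open>f\<close> and \<open>g\<close> act on separate blocks, their quadratic
  minorants simply add up, and differentiability of \<open>F\<close> contributes a remainder of
  lower order. Near \<open>p\<close> the quadratic errors are of lower order too.\<close>

lemma frechet_subdiff_Jfun:
  fixes F :: "'w::real_inner \<times> 'h::real_inner \<Rightarrow> real"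
  assumes F: "(F has_derivative (\<lambda>h. inner G h)) (at p)"
    and fin: "\<bar>f (fst p)\<bar> \<noteq> \<infinity>" "\<bar>g (snd p)\<bar> \<noteq> \<infinity>"
    and f: "\<And>v. f (fst p) + ereal (inner a (v - fst p) - C * (norm (v - fst p))\<^sup>2) \<le> f v"
    and g: "\<And>v. g (snd p) + ereal (inner b (v - snd p) - D * (norm (v - snd p))\<^sup>2) \<le> g v"
    and "C \<ge> 0" "D \<ge> 0"
  shows "G + (a, b) \<in> frechet_subdiff (Jfun F f g) p"
proof -
  have J_fin: "\<bar>Jfun F f g p\<bar> \<noteq> \<infinity>"
    using fin by (auto simp: Jfun_def)
  have "\<exists>\<delta>>0. \<forall>y. norm (y - p) < \<delta> \<longrightarrow>
      Jfun F f g p + ereal (inner (G + (a, b)) (y - p) - e * norm (y - p)) \<le> Jfun F f g y"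
    if "e > 0" for e :: real
  proof -
    obtain d where d: "d > 0"
      and Fd: "\<And>y. norm (y - p) < d \<Longrightarrow> norm (F y - F p - inner G (y - p)) \<le> e / 2 * norm (y - p)"
      using F \<open>e > 0\<close> unfolding has_derivative_at_alt by (meson half_gt_zero)
    \<comment> \<open>Half of the allowance \<open>e\<close> pays for the remainder of
      \<open>F\<close>, the other half for the two quadratic errors. The summand 1 keeps the
      denominator positive when \<open>C = D = 0\<close>.\<close>
    define \<delta> where "\<delta> = min d (e / (2 * (C + D + 1)))"
    have pos: "C + D + 1 > 0" using assms(6,7) by simp
    have "\<delta> > 0" using d \<open>e > 0\<close> pos by (simp add: \<delta>_def)
    moreover have "Jfun F f g p + ereal (inner (G + (a, b)) (y - p) - e * norm (y - p)) \<le> Jfun F f g y"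
      if y: "norm (y - p) < \<delta>" for y
    proof -
      have 1: "F y - F p - inner G (y - p) \<ge> - (e / 2 * norm (y - p))"
        using Fd[of y] y unfolding \<delta>_def real_norm_def by linarith
      have n1: "norm (fst y - fst p) \<le> norm (y - p)" "norm (snd y - snd p) \<le> norm (y - p)"
        using norm_fst_le[of "fst (y - p)" "snd (y - p)"] norm_snd_le[of "snd (y - p)" "fst (y - p)"]
        unfolding prod.collapse by simp_all
      have "C * (norm (fst y - fst p))\<^sup>2 + D * (norm (snd y - snd p))\<^sup>2
          \<le> C * (norm (y - p))\<^sup>2 + D * (norm (y - p))\<^sup>2"
        using assms(6,7) n1 by (intro add_mono mult_left_mono power_mono) auto
      also have "\<dots> \<le> (C + D + 1) * norm (y - p) * norm (y - p)"
        by (simp add: algebra_simps power2_eq_square)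
      also have "\<dots> \<le> e / 2 * norm (y - p)"
      proof (rule mult_right_mono)
        have "norm (y - p) \<le> e / (2 * (C + D + 1))" using y by (simp add: \<delta>_def)
        then show "(C + D + 1) * norm (y - p) \<le> e / 2"
          using pos by (simp add: field_simps)
      qed simp
      finally have 2: "C * (norm (fst y - fst p))\<^sup>2 + D * (norm (snd y - snd p))\<^sup>2
          \<le> e / 2 * norm (y - p)" .
      have 3: "inner (G + (a, b)) (y - p)
          = inner G (y - p) + inner a (fst y - fst p) + inner b (snd y - snd p)"
        by (simp add: inner_add_left inner_prod_def)
      obtain fp gp where p: "f (fst p) = ereal fp" "g (snd p) = ereal gp"
        using fin by auto
      show ?thesis
      proof (cases "f (fst y) = \<infinity> \<or> g (snd y) = \<infinity>")
        case True
        \<comment> \<open>The real minorants exclude negative infinity, so one infinite summand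
          makes the whole sum positive infinity.\<close>
        have "f (fst y) \<noteq> -\<infinity>" "g (snd y) \<noteq> -\<infinity>"
          using f[of "fst y"] g[of "snd y"] p by auto
        with True have "Jfun F f g y = \<infinity>" by (auto simp: Jfun_def)
        then show ?thesis by simp
      next
        case False
        then obtain fy gy where q: "f (fst y) = ereal fy" "g (snd y) = ereal gy"
          using f[of "fst y"] g[of "snd y"] p by (cases "f (fst y)"; cases "g (snd y)") auto
        show ?thesis
          using f[of "fst y"] g[of "snd y"] 1 2 unfolding Jfun_def p q 3 by simp
      qed
    qed
    ultimately show ?thesis by blast
  qed
  with J_fin show ?thesis by (simp add: frechet_subdiff_def)
qed

lemma frechet_subdiff_subset_limiting: "frechet_subdiff J x \<subseteq> limiting_subdiff J x"
  unfolding limiting_subdiff_def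
  by (auto intro!: exI[of _ "\<lambda>_. x"] exI[of _ "\<lambda>_. v" for v])

section \<open>Convergence rates from a recursive inequality\<close>

text \<open>The power is taken of the new value, since the subgradient is controlled at the new
  iterate. The guard \<open>r (Suc k) > 0\<close> reflects that the KL inequality speaks only of
  values strictly above the limit. The exponent \<open>s\<close> will be
  \<open>2 * (1 - \<theta>)\<close>.\<close>

locale recursive_decrease =
  fixes r :: "nat \<Rightarrow> real" and \<kappa> s :: real and N :: nat
  assumes r_nonneg: "\<And>k. 0 \<le> r k"
    and r_decseq: "decseq r"
    and r_lim: "r \<longlonglongrightarrow> 0"
    and \<kappa>_pos: "\<kappa> > 0"
    and decrease: "\<And>k. k \<ge> N \<Longrightarrow> r (Suc k) > 0 \<Longrightarrow> \<kappa> * r (Suc k) powr s \<le> r k - r (Suc k)"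
begin

text \<open>With exponent 0, every step that ends at a positive value loses at least \<kappa>, which
  is impossible once \<open>r\<close> has fallen below \<kappa>.\<close>

lemma finite_termination:
  assumes "s = 0"
  shows "\<exists>K. \<forall>k\<ge>K. r k = 0"
proof -
  have "eventually (\<lambda>k. r k < \<kappa>) sequentially"
    using r_lim \<kappa>_pos by (rule order_tendstoD(2))
  then obtain M where M: "\<And>k. k \<ge> M \<Longrightarrow> r k < \<kappa>"
    by (auto simp: eventually_sequentially)
  have "r (Suc k) = 0" if "k \<ge> max M N" for k
  proof (rule ccontr)
    assume "r (Suc k) \<noteq> 0"
    with r_nonneg[of "Suc k"] have pos: "r (Suc k) > 0" by simp
    with decrease[of k] that have "\<kappa> \<le> r k - r (Suc k)" by (simp add: assms)
    with M[of k] pos that show False by simp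
  qed
  then have "r k = 0" if "k \<ge> Suc (max M N)" for k
    using that by (cases k) auto
  then show ?thesis by blast
qed

text \<open>Both remaining rates compare powers of \<open>r\<close> with different exponents, which
  requires values in the unit interval.\<close>

lemma eventually_le_one: "\<exists>M\<ge>N. \<forall>k\<ge>M. r k \<le> 1"
proof -
  have "eventually (\<lambda>k. r k < 1) sequentially"
    using r_lim by (rule order_tendstoD(2)) simp
  then obtain M where "\<And>k. k \<ge> M \<Longrightarrow> r k < 1"
    by (auto simp: eventually_sequentially)
  then show ?thesis by (intro exI[of _ "max M N"]) (auto intro: less_imp_le)
qed

text \<open>For values at most 1 and \<open>s \<le> 1\<close>, the power in the recursion dominates
  the value itself. Hence \<open>(1 + \<kappa>) * r (Suc k) \<le> r k\<close>, a contraction with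
  the factor \<open>1 / (1 + \<kappa>)\<close>.\<close>

lemma linear_rate:
  assumes s: "0 < s" "s \<le> 1" and M: "M \<ge> N" "\<And>k. k \<ge> M \<Longrightarrow> r k \<le> 1"
  shows "\<exists>P. 0 \<le> P \<and> P < 1 \<and> (\<forall>k\<ge>M. r k \<le> r M * P ^ (k - M))"
proof -
  define P where "P = 1 / (1 + \<kappa>)"
  have P: "0 \<le> P" "P < 1" using \<kappa>_pos by (auto simp: P_def)
  have step: "r (Suc k) \<le> r k * P" if "k \<ge> M" for k
  proof (cases "r (Suc k) = 0")
    case True
    then show ?thesis using r_nonneg[of k] P by simp
  next
    case False
    with r_nonneg[of "Suc k"] have pos: "r (Suc k) > 0" by simp
    have "r (Suc k) powr 1 \<le> r (Suc k) powr s"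
      using pos M(2)[of "Suc k"] s that by (intro powr_mono') auto
    then have "\<kappa> * r (Suc k) \<le> \<kappa> * r (Suc k) powr s"
      using pos \<kappa>_pos by simp
    with decrease[of k] pos that M(1) have "\<kappa> * r (Suc k) \<le> r k - r (Suc k)" by simp
    then show ?thesis using \<kappa>_pos by (simp add: P_def field_simps)
  qed
  have "r k \<le> r M * P ^ (k - M)" if "k \<ge> M" for k
    using that
  proof (induction k rule: dec_induct)
    case (step k)
    have "r (Suc k) \<le> r k * P" using assms step by (intro \<open>\<And>k. M \<le> k \<Longrightarrow> r (Suc k) \<le> r k * P\<close>) simp
    also have "\<dots> \<le> r M * P ^ (k - M) * P" using step P by (intro mult_right_mono) auto
    finally show ?case using step by (simp add: Suc_diff_le algebra_simps)
  qed simp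
  with P show ?thesis by blast
qed

text \<open>The quantity \<open>r k powr (1 - s)\<close> grows at least linearly, because
  \<open>1 - (1 + \<kappa> t) powr (1 - s)\<close> is of order \<open>t\<close> for \<open>t\<close> in the unit interval.\<close>

lemma sublinear_rate:
  assumes s: "1 < s" and M: "M \<ge> N" "\<And>k. k \<ge> M \<Longrightarrow> r k \<le> 1"
  shows "\<exists>Q>0. \<forall>k>M. r k \<le> (Q / (real (k - M) * (s - 1))) powr (1 / (s - 1))"
proof -
  define a where "a = s - 1"
  have a: "a > 0" using s by (simp add: a_def)
  \<comment> \<open>The bound \<open>x / (1 + x) \<le> ln (1 + x)\<close> at
    \<open>x = \<kappa> * t\<close> with \<open>t \<le> 1\<close> gives
    \<open>m * t \<le> a * ln (1 + \<kappa> * t)\<close>.\<close>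
  define m where "m = a * \<kappa> / (1 + \<kappa>)"
  have m: "m > 0" using a \<kappa>_pos by (simp add: m_def)
  \<comment> \<open>Partial fractions leave the gap \<open>m / (1 + m * t)\<close> between
    \<open>1 / t\<close> and \<open>(1 / t) * (1 / (1 + m * t))\<close>; \<mu> is its smallest value
    for \<open>t \<le> 1\<close>.\<close>
  define \<mu> where "\<mu> = m / (1 + m)"
  have \<mu>: "\<mu> > 0" using m by (simp add: \<mu>_def)
  have step: "r (Suc k) powr (- a) \<ge> r k powr (- a) + \<mu>" if k: "k \<ge> M" and pos: "r (Suc k) > 0" for k
  proof -
    \<comment> \<open>With this abbreviation the recursion reads
      \<open>r k \<ge> r (Suc k) * (1 + \<kappa> * t)\<close>, and \<open>1 / t\<close> is the
      quantity whose growth is tracked.\<close>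
    define t where "t = r (Suc k) powr a"
    have t: "0 < t" "t \<le> 1"
      using pos M(2)[of "Suc k"] k a by (auto simp: t_def intro: powr_le1)
    have "r (Suc k) powr s = r (Suc k) * t"
      using pos by (simp add: t_def a_def powr_diff)
    with decrease[of k] k M(1) pos have rk: "r k \<ge> r (Suc k) * (1 + \<kappa> * t)"
      by (simp add: algebra_simps)
    have t1: "1 + \<kappa> * t > 0" using t \<kappa>_pos by (simp add: add_pos_pos)
    have "r k powr (- a) \<le> (r (Suc k) * (1 + \<kappa> * t)) powr (- a)"
      using rk pos t1 a by (intro powr_mono2') auto
    also have "\<dots> = (1 / t) * (1 + \<kappa> * t) powr (- a)"
      using pos t1 by (simp add: powr_mult t_def powr_minus_divide)
    finally have 1: "r k powr (- a) \<le> (1 / t) * (1 + \<kappa> * t) powr (- a)" .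
    have "m * t \<le> a * ln (1 + \<kappa> * t)"
    proof -
      have "- ln (1 + \<kappa> * t) = ln (1 / (1 + \<kappa> * t))" using t1 by (simp add: ln_div)
      also have "\<dots> \<le> 1 / (1 + \<kappa> * t) - 1" using t1 by (intro ln_le_minus_one) simp
      also have "\<dots> = - (\<kappa> * t / (1 + \<kappa> * t))" using t1 by (simp add: field_simps)
      finally have "\<kappa> * t / (1 + \<kappa> * t) \<le> ln (1 + \<kappa> * t)" by simp
      moreover have "\<kappa> * t / (1 + \<kappa>) \<le> \<kappa> * t / (1 + \<kappa> * t)"
        using t \<kappa>_pos t1 by (intro divide_left_mono) auto
      ultimately have "a * (\<kappa> * t / (1 + \<kappa>)) \<le> a * ln (1 + \<kappa> * t)"
        using a by (intro mult_left_mono) auto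
      then show ?thesis by (simp add: m_def)
    qed
    then have "1 + m * t \<le> exp (a * ln (1 + \<kappa> * t))"
      using exp_ge_add_one_self[of "a * ln (1 + \<kappa> * t)"] by linarith
    also have "\<dots> = (1 + \<kappa> * t) powr a" using t1 by (simp add: powr_def)
    finally have "(1 + \<kappa> * t) powr (- a) \<le> 1 / (1 + m * t)"
      using m t by (simp add: powr_minus_divide frac_le add_pos_pos)
    then have "(1 / t) * (1 + \<kappa> * t) powr (- a) \<le> (1 / t) * (1 / (1 + m * t))"
      using t by (intro mult_left_mono) auto
    also have "\<dots> = 1 / t - m / (1 + m * t)"
      using t m by (simp add: divide_simps add_pos_pos) (simp add: algebra_simps add_nonneg_eq_0_iff)
    also have "\<dots> \<le> 1 / t - \<mu>"
      unfolding \<mu>_def using t m by (intro diff_left_mono divide_left_mono) (auto simp: add_pos_pos)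
    finally have "(1 / t) * (1 + \<kappa> * t) powr (- a) \<le> 1 / t - \<mu>" .
    moreover have "1 / t = r (Suc k) powr (- a)" by (simp add: t_def powr_minus_divide)
    ultimately show ?thesis using 1 by simp
  qed
  have growth: "r k powr (- a) \<ge> real (k - M) * \<mu>" if "k \<ge> M" "r k > 0" for k
    using that
  proof (induction k rule: dec_induct)
    case (step k)
    have "r k \<ge> r (Suc k)" using r_decseq by (simp add: decseq_Suc_iff)
    with step have "real (k - M) * \<mu> \<le> r k powr (- a)" by simp
    moreover have "r k powr (- a) + \<mu> \<le> r (Suc k) powr (- a)"
      using step.prems step.hyps
        \<open>\<And>k. M \<le> k \<Longrightarrow> 0 < r (Suc k) \<Longrightarrow> r k powr (- a) + \<mu> \<le> r (Suc k) powr (- a)\<close> by simp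
    ultimately show ?case using step.hyps by (simp add: Suc_diff_le algebra_simps)
  qed simp
  \<comment> \<open>The constant \<open>a / \<mu>\<close> makes the factor \<open>a\<close> of the
    required form cancel. Inverting the growth bound needs a positive base, hence
    \<open>k > M\<close>.\<close>
  have "r k \<le> ((a / \<mu>) / (real (k - M) * a)) powr (1 / a)" if k: "k > M" for k
  proof (cases "r k = 0")
    case False
    with r_nonneg[of k] have pos: "r k > 0" by simp
    have pos': "real (k - M) * \<mu> > 0" using k \<mu> by simp
    have "r k = (r k powr (- a)) powr (- (1 / a))" using pos a by (simp add: powr_powr)
    also have "\<dots> \<le> (real (k - M) * \<mu>) powr (- (1 / a))"
      using growth[of k] k pos pos' a by (intro powr_mono2') auto
    also have "\<dots> = (1 / (real (k - M) * \<mu>)) powr (1 / a)"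
      using pos' by (simp add: powr_minus_divide powr_divide)
    also have "1 / (real (k - M) * \<mu>) = (a / \<mu>) / (real (k - M) * a)"
      using a by simp
    finally show ?thesis .
  qed simp
  then show ?thesis using a \<mu> unfolding a_def by (intro exI[of _ "(s - 1) / \<mu>"]) auto
qed

end

section \<open>Proximal steps from arbitrary base points\<close>

text \<open>Accepted and rejected extrapolations are treated alike: \<open>y k\<close> is any
  bounded base point from which the alternating proximal step produces \<open>z (Suc k)\<close>. The
  decrease is assumed here because its source differs between the two branches.\<close>

locale palm_sequence =
  fixes F :: "'w::euclidean_space \<times> 'h::euclidean_space \<Rightarrow> real"
    and grad :: "'w \<times> 'h \<Rightarrow> 'w \<times> 'h"
    and f :: "'w \<Rightarrow> ereal" and g :: "'h \<Rightarrow> ereal"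
    and \<rho> cbar dbar :: real
    and cs ds :: "nat \<Rightarrow> real"
    and z y :: "nat \<Rightarrow> 'w \<times> 'h"
  assumes f_proper: "proper_fun f" and f_lsc: "lsc_fun f"
    and g_proper: "proper_fun g" and g_lsc: "lsc_fun g"
    and J_bdd: "\<exists>m. \<forall>w. ereal m \<le> Jfun F f g w"
    and F_grad: "\<And>w. (F has_derivative (\<lambda>h. inner (grad w) h)) (at w)"
    and grad_lip_bdd: "\<And>B. bounded B \<Longrightarrow>
          \<exists>L. \<forall>u\<in>B. \<forall>v\<in>B. norm (grad u - grad v) \<le> L * norm (u - v)"
    and \<rho>_pos: "\<rho> > 0"
    and cs: "\<And>k. 0 < cs k \<and> cs k \<le> cbar"
    and ds: "\<And>k. 0 < ds k \<and> ds k \<le> dbar"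
    and init: "f (fst (z 0)) < \<infinity>" "g (snd (z 0)) < \<infinity>"
    and prox_f: "\<And>k. is_prox f (cs k) (fst (y k) - (1 / cs k) *\<^sub>R fst (grad (y k))) (fst (z (Suc k)))"
    and prox_g: "\<And>k. is_prox g (ds k)
          (snd (y k) - (1 / ds k) *\<^sub>R snd (grad (fst (z (Suc k)), snd (y k)))) (snd (z (Suc k)))"
    and J_descent: "\<And>k. Jfun F f g (z (Suc k)) \<le> Jfun F f g (z k) - ereal (\<rho> * (norm (z (Suc k) - y k))\<^sup>2)"
    and z_bdd: "bounded (range z)" and y_bdd: "bounded (range y)"
begin

abbreviation J :: "'w \<times> 'h \<Rightarrow> ereal" where "J \<equiv> Jfun F f g"

text \<open>\<open>real_of_ereal\<close> sends infinities to 0, but all values along the sequence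
  are finite by \<open>f_iterate\<close> and \<open>g_iterate\<close>.\<close>

definition fr :: "nat \<Rightarrow> real" where "fr k = real_of_ereal (f (fst (z k)))"
definition gr :: "nat \<Rightarrow> real" where "gr k = real_of_ereal (g (snd (z k)))"
definition Jr :: "nat \<Rightarrow> real" where "Jr k = F (z k) + fr k + gr k"

lemma f_iterate: "f (fst (z k)) = ereal (fr k)"
proof -
  have "\<bar>f (fst (z k))\<bar> \<noteq> \<infinity>"
  proof (cases k)
    case 0
    have "f (fst (z 0)) \<noteq> -\<infinity>" using f_proper by (simp add: proper_fun_def)
    with 0 init show ?thesis by auto
  next
    case (Suc j)
    with is_prox_finite[OF f_proper prox_f[of j]] show ?thesis by simp
  qed
  then show ?thesis by (simp add: fr_def ereal_real)
qed

lemma g_iterate: "g (snd (z k)) = ereal (gr k)"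
proof -
  have "\<bar>g (snd (z k))\<bar> \<noteq> \<infinity>"
  proof (cases k)
    case 0
    have "g (snd (z 0)) \<noteq> -\<infinity>" using g_proper by (simp add: proper_fun_def)
    with 0 init show ?thesis by auto
  next
    case (Suc j)
    with is_prox_finite[OF g_proper prox_g[of j]] show ?thesis by simp
  qed
  then show ?thesis by (simp add: gr_def ereal_real)
qed

lemma J_iterate: "J (z k) = ereal (Jr k)"
  by (simp add: Jfun_def f_iterate g_iterate Jr_def)

lemma Jr_descent: "\<rho> * (norm (z (Suc k) - y k))\<^sup>2 \<le> Jr k - Jr (Suc k)"
  using J_descent[of k] by (simp add: J_iterate)

lemma Jr_decseq: "decseq Jr"
proof (rule decseq_SucI)
  fix k
  have "0 \<le> \<rho> * (norm (z (Suc k) - y k))\<^sup>2" using \<rho>_pos by simp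
  with Jr_descent[of k] show "Jr (Suc k) \<le> Jr k" by linarith
qed

lemma Jr_convergent: "\<exists>l. Jr \<longlonglongrightarrow> l"
proof -
  obtain m where m: "\<And>w. ereal m \<le> J w" using J_bdd by blast
  have "m \<le> Jr k" for k using m[of "z k"] by (simp add: J_iterate)
  then show ?thesis using decseq_convergent[OF Jr_decseq] by blast
qed

text \<open>Consecutive differences of the convergent sequence \<open>Jr\<close> vanish, and by
  \<open>Jr_descent\<close> they dominate the squared steps.\<close>

lemma step_tendsto_zero: "(\<lambda>k. z (Suc k) - y k) \<longlonglongrightarrow> 0"
proof -
  obtain l where l: "Jr \<longlonglongrightarrow> l" using Jr_convergent by blast
  have "(\<lambda>k. (Jr k - Jr (Suc k)) / \<rho>) \<longlonglongrightarrow> (l - l) / \<rho>"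
    using \<rho>_pos l by (intro tendsto_intros LIMSEQ_Suc) auto
  then have lim: "(\<lambda>k. (Jr k - Jr (Suc k)) / \<rho>) \<longlonglongrightarrow> 0" by simp
  have "(\<lambda>k. (norm (z (Suc k) - y k))\<^sup>2) \<longlonglongrightarrow> 0"
  proof (rule tendsto_sandwich[OF _ _ tendsto_const lim])
    show "\<forall>\<^sub>F k in sequentially. (norm (z (Suc k) - y k))\<^sup>2 \<le> (Jr k - Jr (Suc k)) / \<rho>"
      using Jr_descent \<rho>_pos by (auto simp: field_simps)
  qed simp
  then have "(\<lambda>k. norm (z (Suc k) - y k)) \<longlonglongrightarrow> 0"
    using tendsto_real_sqrt[of "\<lambda>k. (norm (z (Suc k) - y k))\<^sup>2" 0] by simp
  then show ?thesis by (rule tendsto_norm_zero_cancel)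
qed

section \<open>Limit values and subgradients along the sequence\<close>

lemma grad_continuous: "isCont grad x"
proof -
  obtain L where L: "\<And>u v. u \<in> cball x 1 \<Longrightarrow> v \<in> cball x 1 \<Longrightarrow> norm (grad u - grad v) \<le> L * norm (u - v)"
    using grad_lip_bdd[OF bounded_cball[of x 1]] by blast
  have "((\<lambda>u. L * norm (u - x)) \<longlongrightarrow> L * norm (x - x)) (at x)"
    by (intro tendsto_intros)
  then have lim: "((\<lambda>u. L * norm (u - x)) \<longlongrightarrow> 0) (at x)" by simp
  have "\<forall>\<^sub>F u in at x. norm (grad u - grad x) \<le> L * norm (u - x)"
    unfolding eventually_at by (intro exI[of _ 1]) (auto intro!: L simp: dist_commute)
  then have "((\<lambda>u. grad u - grad x) \<longlongrightarrow> 0) (at x)"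
    using lim by (rule Lim_null_comparison)
  then show ?thesis by (simp add: isCont_def LIM_zero_iff)
qed

lemma F_continuous: "isCont F x"
  using F_grad has_derivative_continuous by blast

text \<open>Comparing the proximal steps with a limit point \<open>x\<close> bounds the iterates' values by \<open>J x\<close>
  from above; lower semicontinuity gives the bound from below.\<close>

lemma Jr_tendsto_limit_value:
  assumes s: "strict_mono s" "(\<lambda>j. z (Suc (s j))) \<longlonglongrightarrow> x" and Jx: "J x = ereal Jx"
  shows "Jr \<longlonglongrightarrow> Jx"
proof -
  obtain l where l: "Jr \<longlonglongrightarrow> l" using Jr_convergent by blast
  have fin: "f (fst x) \<noteq> -\<infinity>" "g (snd x) \<noteq> -\<infinity>"
    using f_proper g_proper by (auto simp: proper_fun_def)
  then obtain fx gx where fx: "f (fst x) = ereal fx" and gx: "g (snd x) = ereal gx"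
    using Jx by (cases "f (fst x)"; cases "g (snd x)") (auto simp: Jfun_def)
  have Jx_eq: "Jx = F x + fx + gx" using Jx by (simp add: Jfun_def fx gx)
  \<comment> \<open>The shift by \<open>Suc\<close> makes \<open>Z j\<close> the outcome of the
    proximal step from \<open>Y j\<close>. As steps vanish, both sequences tend to
    \<open>x\<close>.\<close>
  define Z where "Z j = z (Suc (s j))" for j
  define Y where "Y j = y (s j)" for j
  have Z: "Z \<longlonglongrightarrow> x" using s(2) by (simp add: Z_def[abs_def])
  have ZY: "(\<lambda>j. Z j - Y j) \<longlonglongrightarrow> 0"
    using LIMSEQ_subseq_LIMSEQ[OF step_tendsto_zero s(1)] by (simp add: Z_def Y_def o_def)
  have Y: "Y \<longlonglongrightarrow> x"
    using tendsto_diff[OF Z ZY] by simp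
  have FZ: "(\<lambda>j. F (Z j)) \<longlonglongrightarrow> F x"
    using F_continuous Z by (rule isCont_tendsto_compose)
  have JZ: "(\<lambda>j. Jr (Suc (s j))) \<longlonglongrightarrow> l"
    using LIMSEQ_subseq_LIMSEQ[OF LIMSEQ_Suc[OF l] s(1)] by (simp add: o_def)
  \<comment> \<open>The limit point serves as competitor in the proximal step; the quadratic term on
    the left is dropped and the step size on the right is replaced by its upper bound.\<close>
  have upper_f: "fr (Suc (s j)) \<le> fx + inner (fst (grad (Y j))) (fst x - fst (Z j))
      + cbar / 2 * (norm (fst x - fst (Y j)))\<^sup>2" for j
  proof -
    have c: "0 < cs (s j)" "cs (s j) \<le> cbar" using cs by auto
    from is_prox_gradient_step[OF prox_f c(1), of "fst x"]
    have "fr (Suc (s j)) + (inner (fst (grad (Y j))) (fst (Z j) - fst (Y j))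
        + cs (s j) / 2 * (norm (fst (Z j) - fst (Y j)))\<^sup>2)
      \<le> fx + (inner (fst (grad (Y j))) (fst x - fst (Y j)) + cs (s j) / 2 * (norm (fst x - fst (Y j)))\<^sup>2)"
      by (simp add: f_iterate fx Z_def Y_def)
    moreover have "0 \<le> cs (s j) / 2 * (norm (fst (Z j) - fst (Y j)))\<^sup>2" using c by simp
    moreover have "cs (s j) / 2 * (norm (fst x - fst (Y j)))\<^sup>2 \<le> cbar / 2 * (norm (fst x - fst (Y j)))\<^sup>2"
      using c by (intro mult_right_mono) auto
    ultimately show ?thesis by (simp add: inner_diff_right)
  qed
  have upper_g: "gr (Suc (s j)) \<le> gx + inner (snd (grad (fst (Z j), snd (Y j)))) (snd x - snd (Z j))
      + dbar / 2 * (norm (snd x - snd (Y j)))\<^sup>2" for j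
  proof -
    have d: "0 < ds (s j)" "ds (s j) \<le> dbar" using ds by auto
    from is_prox_gradient_step[OF prox_g d(1), of "snd x"]
    have "gr (Suc (s j)) + (inner (snd (grad (fst (Z j), snd (Y j)))) (snd (Z j) - snd (Y j))
        + ds (s j) / 2 * (norm (snd (Z j) - snd (Y j)))\<^sup>2)
      \<le> gx + (inner (snd (grad (fst (Z j), snd (Y j)))) (snd x - snd (Y j))
        + ds (s j) / 2 * (norm (snd x - snd (Y j)))\<^sup>2)"
      by (simp add: g_iterate gx Z_def Y_def)
    moreover have "0 \<le> ds (s j) / 2 * (norm (snd (Z j) - snd (Y j)))\<^sup>2" using d by simp
    moreover have "ds (s j) / 2 * (norm (snd x - snd (Y j)))\<^sup>2 \<le> dbar / 2 * (norm (snd x - snd (Y j)))\<^sup>2"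
      using d by (intro mult_right_mono) auto
    ultimately show ?thesis by (simp add: inner_diff_right)
  qed
  define E where "E j = (inner (fst (grad (Y j))) (fst x - fst (Z j))
      + cbar / 2 * (norm (fst x - fst (Y j)))\<^sup>2)
      + (inner (snd (grad (fst (Z j), snd (Y j)))) (snd x - snd (Z j))
      + dbar / 2 * (norm (snd x - snd (Y j)))\<^sup>2)" for j
  have gradY: "(\<lambda>j. grad (Y j)) \<longlonglongrightarrow> grad x"
    using grad_continuous Y by (rule isCont_tendsto_compose)
  have "(\<lambda>j. (fst (Z j), snd (Y j))) \<longlonglongrightarrow> (fst x, snd x)"
    by (intro tendsto_intros Z Y)
  then have gradZY: "(\<lambda>j. grad (fst (Z j), snd (Y j))) \<longlonglongrightarrow> grad x"
    using isCont_tendsto_compose[OF grad_continuous] by simp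
  have "E \<longlonglongrightarrow> (inner (fst (grad x)) (fst x - fst x) + cbar / 2 * (norm (fst x - fst x))\<^sup>2)
      + (inner (snd (grad x)) (snd x - snd x) + dbar / 2 * (norm (snd x - snd x))\<^sup>2)"
    unfolding E_def[abs_def] by (intro tendsto_intros gradY gradZY Z Y)
  then have "E \<longlonglongrightarrow> 0" by simp
  then have "(\<lambda>j. F (Z j) + fx + gx + E j) \<longlonglongrightarrow> F x + fx + gx + 0"
    by (intro tendsto_intros FZ)
  then have "(\<lambda>j. F (Z j) + fx + gx + E j) \<longlonglongrightarrow> Jx" by (simp add: Jx_eq)
  moreover have "Jr (Suc (s j)) \<le> F (Z j) + fx + gx + E j" for j
    using upper_f[of j] upper_g[of j] by (simp add: Jr_def E_def Z_def)
  ultimately have le: "l \<le> Jx" using LIMSEQ_le[OF JZ] by blast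
  have ge: "Jx \<le> l"
  \<comment> \<open>Lower semicontinuity is applied to \<open>f\<close> and \<open>g\<close>
    separately, each with tolerance \<open>e / 2\<close>.\<close>
  proof (rule field_le_epsilon)
    fix e :: real assume "e > 0"
    have "f (fst x) \<le> liminf (\<lambda>j. f (fst (Z j)))"
      using f_lsc tendsto_fst[OF Z] unfolding lsc_fun_def by blast
    moreover have "ereal (fx - e / 2) < f (fst x)" using \<open>e > 0\<close> by (simp add: fx)
    ultimately have "ereal (fx - e / 2) < liminf (\<lambda>j. f (fst (Z j)))" by (rule less_le_trans[rotated])
    then have ef: "\<forall>\<^sub>F j in sequentially. fx - e / 2 < fr (Suc (s j))"
      using less_LiminfD by (fastforce simp: Z_def f_iterate)
    have "g (snd x) \<le> liminf (\<lambda>j. g (snd (Z j)))"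
      using g_lsc tendsto_snd[OF Z] unfolding lsc_fun_def by blast
    moreover have "ereal (gx - e / 2) < g (snd x)" using \<open>e > 0\<close> by (simp add: gx)
    ultimately have "ereal (gx - e / 2) < liminf (\<lambda>j. g (snd (Z j)))" by (rule less_le_trans[rotated])
    then have eg: "\<forall>\<^sub>F j in sequentially. gx - e / 2 < gr (Suc (s j))"
      using less_LiminfD by (fastforce simp: Z_def g_iterate)
    have "(\<lambda>j. F (Z j) + fx + gx - e) \<longlonglongrightarrow> F x + fx + gx - e"
      by (intro tendsto_intros FZ)
    moreover have "\<forall>\<^sub>F j in sequentially. F (Z j) + fx + gx - e \<le> Jr (Suc (s j))"
      using ef eg by eventually_elim (simp add: Jr_def Z_def)
    ultimately have "F x + fx + gx - e \<le> l"
      using JZ by (intro tendsto_le[OF sequentially_bot])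
    then show "Jx \<le> l + e" by (simp add: Jx_eq)
  qed
  from le ge l show ?thesis by simp
qed

text \<open>The inner sequence \<open>k\<close> is kept general: it will be \<open>Suc\<close>, to
  land on outcomes of proximal steps, and later an enumeration of exceptional indices.\<close>

lemma bounded_subsequence:
  assumes "strict_mono (k :: nat \<Rightarrow> nat)"
  obtains x s where "strict_mono s" "(z \<circ> (k \<circ> s)) \<longlonglongrightarrow> x" "strict_mono (k \<circ> s)"
proof -
  have "bounded (range (z \<circ> k))" using z_bdd by (rule bounded_subset) auto
  then obtain x s where "strict_mono s" "((z \<circ> k) \<circ> s) \<longlonglongrightarrow> x"
    using bounded_imp_convergent_subsequence by blast
  then show thesis using that assms by (auto simp: o_assoc strict_mono_o)
qed

text \<open>As \<open>Jr\<close> converges as a whole, its limit can be read off at a single limit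
  point, which boundedness provides.\<close>

lemma Jr_tendsto:
  assumes J_const: "\<And>x. (\<exists>s. strict_mono s \<and> (z \<circ> s) \<longlonglongrightarrow> x) \<Longrightarrow> J x = ereal Jstar"
  shows "Jr \<longlonglongrightarrow> Jstar"
proof -
  obtain x s where s: "strict_mono s" "(z \<circ> (Suc \<circ> s)) \<longlonglongrightarrow> x" "strict_mono (Suc \<circ> s)"
    using bounded_subsequence[of Suc] unfolding strict_mono_def by (metis Suc_less_eq)
  then show ?thesis
    using J_const[of x] by (intro Jr_tendsto_limit_value[of s x]) (auto simp: o_def)
qed

text \<open>The bound involves only the distance to the point \<open>y k\<close> at which the step is taken, hence it
  matches \<open>J_descent\<close> without any control on \<open>z (Suc k) - z k\<close>.\<close>

lemma subgradient_bound:
  "\<exists>C>0. \<forall>k. dist0 (limiting_subdiff J (z (Suc k))) \<le> ereal (C * norm (z (Suc k) - y k))"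
proof -
  obtain B where B: "\<And>k. norm (z k) \<le> B" "\<And>k. norm (y k) \<le> B"
  proof -
    obtain B1 B2 where "\<And>k. norm (z k) \<le> B1" "\<And>k. norm (y k) \<le> B2"
      using z_bdd y_bdd by (auto simp: bounded_iff)
    then show thesis by (intro that[of "max B1 B2"]) (auto simp: le_max_iff_disj)
  qed
  \<comment> \<open>The radius is doubled to contain the mixed points \<open>(fst Z, snd Y)\<close>,
    whose norm is bounded by a sum of two norms.\<close>
  obtain L0 where L0: "\<And>u v. u \<in> cball 0 (2 * B) \<Longrightarrow> v \<in> cball 0 (2 * B) \<Longrightarrow>
      norm (grad u - grad v) \<le> L0 * norm (u - v)"
    using grad_lip_bdd[OF bounded_cball[of 0 "2 * B"]] by blast
  define L where "L = max L0 0"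
  have L: "norm (grad u - grad v) \<le> L * norm (u - v)"
    if "norm u \<le> 2 * B" "norm v \<le> 2 * B" for u v
  proof -
    have "norm (grad u - grad v) \<le> L0 * norm (u - v)" using that by (intro L0) auto
    also have "\<dots> \<le> L * norm (u - v)" by (intro mult_right_mono) (auto simp: L_def)
    finally show ?thesis .
  qed
  have B0: "0 \<le> B" using B(1)[of 0] norm_ge_zero[of "z 0"] by linarith
  \<comment> \<open>Each of the two blocks contributes one Lipschitz error and one proximal
    term.\<close>
  define C where "C = 2 * L + cbar + dbar"
  have "C > 0" using cs[of 0] ds[of 0] max.cobounded2[of 0 L0] unfolding C_def L_def by linarith
  moreover have "dist0 (limiting_subdiff J (z (Suc k))) \<le> ereal (C * norm (z (Suc k) - y k))" for k
  proof -
    define Z Y where "Z = z (Suc k)" and "Y = y k"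
    \<comment> \<open>The second block evaluates the gradient after the first has been updated. In
      \<open>grad Z + (a, b)\<close> the gradients taken at \<open>Y\<close> and \<open>M\<close>
      cancel against those at \<open>Z\<close> up to Lipschitz errors.\<close>
    define M where "M = (fst Z, snd Y)"
    define a where "a = - fst (grad Y) - cs k *\<^sub>R (fst Z - fst Y)"
    define b where "b = - snd (grad M) - ds k *\<^sub>R (snd Z - snd Y)"
    have c: "0 < cs k" "cs k \<le> cbar" and d: "0 < ds k" "ds k \<le> dbar" using cs ds by auto
    have "grad Z + (a, b) \<in> frechet_subdiff J Z"
    proof (rule frechet_subdiff_Jfun)
      show "\<bar>f (fst Z)\<bar> \<noteq> \<infinity>" "\<bar>g (snd Z)\<bar> \<noteq> \<infinity>"
        by (simp_all add: Z_def f_iterate g_iterate)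
      show "f (fst Z) + ereal (inner a (v - fst Z) - cs k / 2 * (norm (v - fst Z))\<^sup>2) \<le> f v" for v
        unfolding a_def Z_def Y_def by (rule is_prox_proximal_subgradient[OF prox_f c(1)])
      show "g (snd Z) + ereal (inner b (v - snd Z) - ds k / 2 * (norm (v - snd Z))\<^sup>2) \<le> g v" for v
        unfolding b_def M_def Z_def Y_def by (rule is_prox_proximal_subgradient[OF prox_g d(1)])
    qed (use F_grad c d in auto)
    then have "grad Z + (a, b) \<in> limiting_subdiff J Z"
      using frechet_subdiff_subset_limiting by blast
    then have "dist0 (limiting_subdiff J Z) \<le> ereal (norm (grad Z + (a, b)))"
      unfolding dist0_def by (rule INF_lower)
    also have "norm (grad Z + (a, b)) \<le> C * norm (Z - Y)"
    proof -
      have n1: "norm (fst w) \<le> norm w" "norm (snd w) \<le> norm w" for w :: "'w \<times> 'h"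
        using norm_fst_le[of "fst w" "snd w"] norm_snd_le[of "snd w" "fst w"] by simp_all
      have nM: "norm M \<le> 2 * B"
        using norm_Pair_le[of "fst Z" "snd Y"] n1(1)[of Z] n1(2)[of Y] B(1)[of "Suc k"] B(2)[of k]
        by (simp add: M_def Z_def Y_def)
      have nZ: "norm Z \<le> 2 * B" and nY: "norm Y \<le> 2 * B"
        using B(1)[of "Suc k"] B(2)[of k] B0 by (auto simp: Z_def Y_def)
      have ZM: "norm (Z - M) \<le> norm (Z - Y)"
        using n1(2)[of "Z - Y"] by (simp add: M_def norm_prod_def)
      have 1: "norm (fst (grad Z + (a, b))) \<le> L * norm (Z - Y) + cbar * norm (Z - Y)"
      proof -
        have "norm (fst (grad Z + (a, b))) = norm (fst (grad Z - grad Y) - cs k *\<^sub>R fst (Z - Y))"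
          by (simp add: a_def algebra_simps)
        also have "\<dots> \<le> norm (fst (grad Z - grad Y)) + norm (cs k *\<^sub>R fst (Z - Y))"
          by (rule norm_triangle_ineq4)
        also have "\<dots> \<le> L * norm (Z - Y) + cbar * norm (Z - Y)"
          using order_trans[OF n1(1) L[OF nZ nY]] c n1(1)[of "Z - Y"]
          by (intro add_mono) (auto intro!: mult_mono)
        finally show ?thesis .
      qed
      have 2: "norm (snd (grad Z + (a, b))) \<le> L * norm (Z - Y) + dbar * norm (Z - Y)"
      proof -
        have "norm (snd (grad Z + (a, b))) = norm (snd (grad Z - grad M) - ds k *\<^sub>R snd (Z - Y))"
          by (simp add: b_def algebra_simps)
        also have "\<dots> \<le> norm (snd (grad Z - grad M)) + norm (ds k *\<^sub>R snd (Z - Y))"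
          by (rule norm_triangle_ineq4)
        also have "norm (snd (grad Z - grad M)) \<le> L * norm (Z - M)"
          using order_trans[OF n1(2) L[OF nZ nM]] .
        also have "L * norm (Z - M) \<le> L * norm (Z - Y)"
          using ZM by (intro mult_left_mono) (auto simp: L_def)
        also have "norm (ds k *\<^sub>R snd (Z - Y)) \<le> dbar * norm (Z - Y)"
          using d n1(2)[of "Z - Y"] by (auto intro!: mult_mono)
        finally show ?thesis by simp
      qed
      have "norm (grad Z + (a, b)) \<le> norm (fst (grad Z + (a, b))) + norm (snd (grad Z + (a, b)))"
        using norm_Pair_le[of "fst (grad Z + (a, b))" "snd (grad Z + (a, b))"]
        unfolding prod.collapse .
      with 1 2 show ?thesis by (simp add: C_def algebra_simps)
    qed
    finally show ?thesis by (simp add: Z_def Y_def)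
  qed
  ultimately show ?thesis by blast
qed

section \<open>The KL inequality and the resulting recursion\<close>

text \<open>The neighbourhood and \<eta> depend on the limit point, so the argument is by
  contradiction: infinitely many exceptional indices would have a subsequence converging to some
  limit point, whose own neighbourhood and \<eta> eventually capture it.\<close>

lemma eventually_KL:
  assumes J_const: "\<And>x. (\<exists>s. strict_mono s \<and> (z \<circ> s) \<longlonglongrightarrow> x) \<Longrightarrow> J x = ereal Jstar"
    and KL: "\<And>x. (\<exists>s. strict_mono s \<and> (z \<circ> s) \<longlonglongrightarrow> x) \<Longrightarrow> KL_at J x \<phi>"
  shows "\<forall>\<^sub>F k in sequentially. Jr k > Jstar \<longrightarrow>
    ereal (deriv \<phi> (Jr k - Jstar)) * dist0 (limiting_subdiff J (z k)) \<ge> 1"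
proof (rule ccontr)
  let ?P = "\<lambda>k. Jr k > Jstar \<longrightarrow>
    ereal (deriv \<phi> (Jr k - Jstar)) * dist0 (limiting_subdiff J (z k)) \<ge> 1"
  assume "\<not> eventually ?P sequentially"
  then have "infinite {k. \<not> ?P k}"
    by (simp add: cofinite_eq_sequentially[symmetric] eventually_cofinite)
  from infinite_enumerate[OF this] obtain k :: "nat \<Rightarrow> nat"
    where k: "strict_mono k" "\<forall>j. \<not> ?P (k j)"
    by auto
  obtain x s where s: "strict_mono s" "(z \<circ> (k \<circ> s)) \<longlonglongrightarrow> x" "strict_mono (k \<circ> s)"
    using bounded_subsequence[OF k(1)] by blast
  then have lim: "\<exists>s. strict_mono s \<and> (z \<circ> s) \<longlonglongrightarrow> x" by blast
  then have Jx: "J x = ereal Jstar" by (rule J_const)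
  obtain \<eta> U where \<eta>: "\<eta> > 0" and U: "open U" "x \<in> U"
    and KLU: "\<And>w. w \<in> U \<Longrightarrow> J x < J w \<Longrightarrow> J w < J x + ereal \<eta> \<Longrightarrow>
      ereal (deriv \<phi> (real_of_ereal (J w - J x))) * dist0 (limiting_subdiff J w) \<ge> 1"
    using KL[OF lim] unfolding KL_at_def by blast
  have "\<forall>\<^sub>F j in sequentially. z (k (s j)) \<in> U"
    using topological_tendstoD[OF s(2) U] by simp
  moreover have "(\<lambda>j. Jr ((k \<circ> s) j)) \<longlonglongrightarrow> Jstar"
    using LIMSEQ_subseq_LIMSEQ[OF Jr_tendsto[OF J_const] s(3)] by (simp add: o_def)
  then have "\<forall>\<^sub>F j in sequentially. Jr (k (s j)) < Jstar + \<eta>"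
    using order_tendstoD(2)[of "\<lambda>j. Jr ((k \<circ> s) j)" Jstar sequentially "Jstar + \<eta>"] \<eta> by simp
  ultimately have "\<forall>\<^sub>F j in sequentially. ?P (k (s j))"
  proof eventually_elim
    case (elim j)
    with KLU[of "z (k (s j))"] show ?case by (simp add: Jx J_iterate)
  qed
  with k(2) show False by simp
qed

lemma recursive_decrease_values:
  assumes J_const: "\<And>x. (\<exists>s. strict_mono s \<and> (z \<circ> s) \<longlonglongrightarrow> x) \<Longrightarrow> J x = ereal Jstar"
    and KL: "\<And>x. (\<exists>s. strict_mono s \<and> (z \<circ> s) \<longlonglongrightarrow> x) \<Longrightarrow>
      KL_at J x (\<lambda>t. c / \<theta> * t powr \<theta>)"
    and \<theta>: "0 < \<theta>" and c: "c > 0"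
  shows "\<exists>\<kappa> N. recursive_decrease (\<lambda>k. Jr k - Jstar) \<kappa> (2 * (1 - \<theta>)) N"
proof -
  define r where "r k = Jr k - Jstar" for k
  have Jlim: "Jr \<longlonglongrightarrow> Jstar" using J_const by (rule Jr_tendsto)
  obtain C where C: "C > 0" and
    sub: "\<And>k. dist0 (limiting_subdiff J (z (Suc k))) \<le> ereal (C * norm (z (Suc k) - y k))"
    using subgradient_bound by blast
  obtain N where N: "\<And>k. k \<ge> N \<Longrightarrow> r k > 0 \<Longrightarrow>
      ereal (deriv (\<lambda>t. c / \<theta> * t powr \<theta>) (r k)) * dist0 (limiting_subdiff J (z k)) \<ge> 1"
    using eventually_KL[OF J_const KL] by (auto simp: eventually_sequentially r_def)
  \<comment> \<open>With \<open>u\<close> the step length, KL and the subgradient bound give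
    \<open>r (Suc k) powr (1 - \<theta>) \<le> c * C * u\<close>. Squaring and inserting the
    decrease by \<open>\<rho> * u\<^sup>2\<close> yields this constant.\<close>
  define \<kappa> where "\<kappa> = \<rho> / (c * C)\<^sup>2"
  have dec: "\<kappa> * r (Suc k) powr (2 * (1 - \<theta>)) \<le> r k - r (Suc k)"
    if k: "k \<ge> N" and pos: "r (Suc k) > 0" for k
  proof -
    define u where "u = norm (z (Suc k) - y k)"
    have "((\<lambda>t. c / \<theta> * t powr \<theta>) has_real_derivative c * r (Suc k) powr (\<theta> - 1)) (at (r (Suc k)))"
      using pos \<theta> by (auto intro!: derivative_eq_intros)
    then have d: "deriv (\<lambda>t. c / \<theta> * t powr \<theta>) (r (Suc k)) = c * r (Suc k) powr (\<theta> - 1)"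
      by (rule DERIV_imp_deriv)
    have "1 \<le> ereal (c * r (Suc k) powr (\<theta> - 1)) * dist0 (limiting_subdiff J (z (Suc k)))"
      using N[of "Suc k"] k pos d by simp
    also have "\<dots> \<le> ereal (c * r (Suc k) powr (\<theta> - 1)) * ereal (C * u)"
      unfolding u_def using c sub by (intro ereal_mult_left_mono) auto
    finally have "1 \<le> r (Suc k) powr (\<theta> - 1) * (c * C * u)"
      by (simp add: one_ereal_def algebra_simps)
    \<comment> \<open>Multiplication by this power cancels the negative power that comes from the
      derivative of the desingularizing function.\<close>
    then have "r (Suc k) powr (1 - \<theta>) * 1
        \<le> r (Suc k) powr (1 - \<theta>) * (r (Suc k) powr (\<theta> - 1) * (c * C * u))"
      by (intro mult_left_mono) auto
    also have "\<dots> = c * C * u"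
      using pos by (simp add: mult.assoc[symmetric] powr_add[symmetric])
    finally have "(r (Suc k) powr (1 - \<theta>))\<^sup>2 \<le> (c * C * u)\<^sup>2"
      by (intro power_mono) auto
    moreover have "(r (Suc k) powr (1 - \<theta>))\<^sup>2 = r (Suc k) powr (2 * (1 - \<theta>))"
      by (simp add: power2_eq_square powr_add[symmetric])
    ultimately have "\<kappa> * r (Suc k) powr (2 * (1 - \<theta>)) \<le> \<kappa> * (c * C * u)\<^sup>2"
      using \<rho>_pos by (intro mult_left_mono) (auto simp: \<kappa>_def)
    also have "\<dots> = \<rho> * u\<^sup>2"
      using c C by (simp add: \<kappa>_def power_mult_distrib)
    also have "\<dots> \<le> r k - r (Suc k)" using Jr_descent[of k] by (simp add: r_def u_def)
    finally show ?thesis .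
  qed
  have "recursive_decrease r \<kappa> (2 * (1 - \<theta>)) N"
  proof
    show "0 \<le> r k" for k using decseq_ge[OF Jr_decseq Jlim] by (simp add: r_def)
    show "decseq r" using Jr_decseq by (simp add: r_def[abs_def] decseq_def)
    show "r \<longlonglongrightarrow> 0" using Jlim by (simp add: r_def[abs_def] LIM_zero)
    show "\<kappa> > 0" using \<rho>_pos c C by (simp add: \<kappa>_def)
  qed (rule dec)
  then show ?thesis unfolding r_def[abs_def] by blast
qed

text \<open>For \<open>s = 2 * (1 - \<theta>)\<close> the three ranges of \<theta> become
  \<open>s = 0\<close>, \<open>0 < s \<le> 1\<close> and \<open>1 < s\<close>, and
  \<open>s - 1 = 1 - 2 * \<theta>\<close>. One index \<open>M\<close>, past which the recursion
  holds and the values are at most 1, serves as \<open>k2\<close> throughout.\<close>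

theorem convergence_rates:
  assumes J_const: "\<And>x. (\<exists>s. strict_mono s \<and> (z \<circ> s) \<longlonglongrightarrow> x) \<Longrightarrow> J x = ereal Jstar"
    and KL: "\<And>x. (\<exists>s. strict_mono s \<and> (z \<circ> s) \<longlonglongrightarrow> x) \<Longrightarrow>
      KL_at J x (\<lambda>t. c / \<theta> * t powr \<theta>)"
    and \<theta>: "0 < \<theta>" and c: "c > 0"
  shows "\<exists>k2. (let r = (\<lambda>k. J (z k) - ereal Jstar) in
           (\<theta> = 1 \<longrightarrow> (\<exists>K. \<forall>k\<ge>K. r k = 0)) \<and>
           (1/2 \<le> \<theta> \<and> \<theta> < 1 \<longrightarrow>
              (\<exists>P. 0 \<le> P \<and> P < 1 \<and> (\<forall>k\<ge>k2. r k \<le> r k2 * ereal (P ^ (k - k2))))) \<and>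
           (\<theta> < 1/2 \<longrightarrow>
              (\<exists>Q>0. \<forall>k>k2. r k \<le>
                 ereal ((Q / (real (k - k2) * (1 - 2 * \<theta>))) powr (1 / (1 - 2 * \<theta>))))))"
proof -
  obtain \<kappa> N where "recursive_decrease (\<lambda>k. Jr k - Jstar) \<kappa> (2 * (1 - \<theta>)) N"
    using recursive_decrease_values[OF assms] by blast
  then interpret R: recursive_decrease "\<lambda>k. Jr k - Jstar" \<kappa> "2 * (1 - \<theta>)" N .
  obtain M where M: "M \<ge> N" "\<And>k. k \<ge> M \<Longrightarrow> Jr k - Jstar \<le> 1"
    using R.eventually_le_one by blast
  have "2 * (1 - \<theta>) - 1 = 1 - 2 * \<theta>" by simp
  note sublinear = R.sublinear_rate[OF _ M, unfolded this]
  show ?thesis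
    unfolding Let_def J_iterate ereal_minus(1) times_ereal.simps(1) ereal_less_eq(3) ereal_eq_0
  proof (rule exI[of _ M], intro conjI impI)
    show "\<exists>K. \<forall>k\<ge>K. Jr k - Jstar = 0" if "\<theta> = 1"
      using R.finite_termination that by simp
  qed (use R.linear_rate[OF _ _ M] sublinear in auto)
qed

end

section \<open>Decrease of the plain step and reduction of accPALM\<close>

text \<open>The descent lemma is applied in \<open>W\<close> at fixed \<open>H\<close>, then in
  \<open>H\<close> at the new \<open>W'\<close>. Comparing each proximal step with the current block
  cancels the linear terms, and the surplus \<open>(c - LW) / 2\<close> or
  \<open>(d - LH) / 2\<close> is at least \<rho>.\<close>

lemma palm_step_descent:
  fixes F :: "'w::real_inner \<times> 'h::real_inner \<Rightarrow> real"
  assumes F_grad: "\<And>w. (F has_derivative (\<lambda>h. inner (grad w) h)) (at w)"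
    and LipW: "\<And>H W1 W2. norm (fst (grad (W1, H)) - fst (grad (W2, H))) \<le> LW * norm (W1 - W2)"
    and LipH: "\<And>W H1 H2. norm (snd (grad (W, H1)) - snd (grad (W, H2))) \<le> LH * norm (H1 - H2)"
    and c: "LW + 2 * \<rho> \<le> c" "c > 0" and d: "LH + 2 * \<rho> \<le> d" "d > 0"
    and pf: "is_prox f c (W - (1 / c) *\<^sub>R fst (grad (W, H))) W'"
    and pg: "is_prox g d (H - (1 / d) *\<^sub>R snd (grad (W', H))) H'"
  shows "Jfun F f g (W', H') \<le> Jfun F f g (W, H) - ereal (\<rho> * (norm ((W', H') - (W, H)))\<^sup>2)"
proof -
  have "((\<lambda>W. F (W, H)) has_derivative (\<lambda>h. inner (fst (grad (V, H))) h)) (at V)" for V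
    using has_derivative_compose[OF has_derivative_Pair[OF has_derivative_ident has_derivative_const] F_grad]
    by (simp add: inner_prod_def)
  from descent_lemma[OF this LipW, of W' W]
  have 1: "F (W', H) \<le> F (W, H) + inner (fst (grad (W, H))) (W' - W) + LW / 2 * (norm (W' - W))\<^sup>2" .
  have "((\<lambda>H. F (W', H)) has_derivative (\<lambda>h. inner (snd (grad (W', V))) h)) (at V)" for V
    using has_derivative_compose[OF has_derivative_Pair[OF has_derivative_const has_derivative_ident] F_grad]
    by (simp add: inner_prod_def)
  from descent_lemma[OF this LipH, of H' H]
  have 2: "F (W', H') \<le> F (W', H) + inner (snd (grad (W', H))) (H' - H) + LH / 2 * (norm (H' - H))\<^sup>2" .
  have 3: "f W' + ereal (inner (fst (grad (W, H))) (W' - W) + c / 2 * (norm (W' - W))\<^sup>2) \<le> f W"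
    using is_prox_gradient_step[OF pf c(2), of W] by (simp add: zero_ereal_def[symmetric])
  have 4: "g H' + ereal (inner (snd (grad (W', H))) (H' - H) + d / 2 * (norm (H' - H))\<^sup>2) \<le> g H"
    using is_prox_gradient_step[OF pg d(2), of H] by (simp add: zero_ereal_def[symmetric])
  have 5: "(norm ((W', H') - (W, H)))\<^sup>2 = (norm (W' - W))\<^sup>2 + (norm (H' - H))\<^sup>2"
    by (simp add: norm_Pair)
  have "\<rho> * (norm (W' - W))\<^sup>2 \<le> (c - LW) / 2 * (norm (W' - W))\<^sup>2"
    using c by (intro mult_right_mono) auto
  moreover have "\<rho> * (norm (H' - H))\<^sup>2 \<le> (d - LH) / 2 * (norm (H' - H))\<^sup>2"
    using d by (intro mult_right_mono) auto
  ultimately have "F (W', H') + \<rho> * (norm ((W', H') - (W, H)))\<^sup>2 \<le> F (W, H)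
      + (inner (fst (grad (W, H))) (W' - W) + c / 2 * (norm (W' - W))\<^sup>2)
      + (inner (snd (grad (W', H))) (H' - H) + d / 2 * (norm (H' - H))\<^sup>2)"
    using 1 2 unfolding 5 by (simp add: algebra_simps diff_divide_distrib)
  \<comment> \<open>The inequalities are added by splitting the extended values, as
    \<open>f W\<close> and \<open>g H\<close> are not assumed finite here.\<close>
  moreover have "ereal F1 + f W' + g H' \<le> ereal F0 + f W + g H - ereal R"
    if "F1 + R \<le> F0 + A + B" "f W' + ereal A \<le> f W" "g H' + ereal B \<le> g H" for F1 F0 R A B
    using that by (cases "f W"; cases "f W'"; cases "g H"; cases "g H'") auto
  ultimately show ?thesis
    unfolding Jfun_def fst_conv snd_conv using 3 4 by blast
qed

text \<open>Comparing a unit vector with 0 suffices. Nonnegative constants make the step sizes,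
  bounded below by \<open>LW + 2 * \<rho>0\<close> and \<open>LH + 2 * \<rho>0\<close>,
  positive.\<close>

lemma lipschitz_constant_nonneg:
  fixes D :: "'a::euclidean_space \<Rightarrow> 'b::real_normed_vector"
  assumes "\<And>x y. norm (D x - D y) \<le> L * norm (x - y)"
  shows "0 \<le> L"
proof -
  obtain b :: 'a where "b \<in> Basis" using nonempty_Basis by blast
  then have "0 \<le> L * norm b" "norm b = 1"
    using order_trans[OF norm_ge_zero assms[of b 0]] by simp_all
  then show ?thesis by simp
qed

theorem theorem2:
  fixes F :: "(real^'r^'p) \<times> (real^'n^'r) \<Rightarrow> real"
    and grad :: "(real^'r^'p) \<times> (real^'n^'r) \<Rightarrow> (real^'r^'p) \<times> (real^'n^'r)"
    and f :: "real^'r^'p \<Rightarrow> ereal" and g :: "real^'n^'r \<Rightarrow> ereal"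
    and LW LH \<rho>0 \<beta>max cbar dbar Jstar \<theta> cKL :: real
    and \<beta> cs ds :: "nat \<Rightarrow> real"
    and z :: "nat \<Rightarrow> (real^'r^'p) \<times> (real^'n^'r)"
  assumes f_proper: "proper_fun f" and f_lsc: "lsc_fun f"
    and g_proper: "proper_fun g" and g_lsc: "lsc_fun g"
    and J_bdd: "\<exists>m. \<forall>w. ereal m \<le> Jfun F f g w"
    and f_bdd: "\<exists>m. \<forall>W. ereal m \<le> f W"
    and g_bdd: "\<exists>m. \<forall>H. ereal m \<le> g H"
    and F_grad: "\<And>w. (F has_derivative (\<lambda>h. inner (grad w) h)) (at w)"
    and grad_cont: "continuous_on UNIV grad"
    and LipW: "\<And>H W1 W2. norm (fst (grad (W1, H)) - fst (grad (W2, H))) \<le> LW * norm (W1 - W2)"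
    and LipH: "\<And>W H1 H2. norm (snd (grad (W, H1)) - snd (grad (W, H2))) \<le> LH * norm (H1 - H2)"
    and grad_lip_bdd: "\<And>B. bounded B \<Longrightarrow>
          \<exists>L. \<forall>u\<in>B. \<forall>v\<in>B. norm (grad u - grad v) \<le> L * norm (u - v)"
    and rho0: "\<rho>0 > 0"
    and beta_max: "0 \<le> \<beta>max" "\<beta>max < 1"
    and beta: "\<And>k. 0 \<le> \<beta> k \<and> \<beta> k \<le> \<beta>max"
    and step_c: "\<And>k. LW + 2 * \<rho>0 \<le> cs k \<and> cs k \<le> cbar"
    and step_d: "\<And>k. LH + 2 * \<rho>0 \<le> ds k \<and> ds k \<le> dbar"
    and init: "f (fst (z 0)) < \<infinity>" "g (snd (z 0)) < \<infinity>"
    and scheme: "accPALM F grad f g \<rho>0 \<beta> cs ds z"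
    and z_bdd: "bounded (range z)"
    and J_const: "\<And>x. (\<exists>s. strict_mono s \<and> (z \<circ> s) \<longlonglongrightarrow> x) \<Longrightarrow> Jfun F f g x = ereal Jstar"
    and KL: "\<And>x. (\<exists>s. strict_mono s \<and> (z \<circ> s) \<longlonglongrightarrow> x) \<Longrightarrow>
               KL_at (Jfun F f g) x (\<lambda>t. cKL / \<theta> * t powr \<theta>)"
    and theta: "0 < \<theta>" "\<theta> \<le> 1"
    and cKL: "cKL > 0"
  shows "\<exists>k2. (let r = (\<lambda>k. Jfun F f g (z k) - ereal Jstar) in
           (\<theta> = 1 \<longrightarrow> (\<exists>K. \<forall>k\<ge>K. r k = 0)) \<and>
           (1/2 \<le> \<theta> \<and> \<theta> < 1 \<longrightarrow>
              (\<exists>P. 0 \<le> P \<and> P < 1 \<and> (\<forall>k\<ge>k2. r k \<le> r k2 * ereal (P ^ (k - k2))))) \<and>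
           (\<theta> < 1/2 \<longrightarrow>
              (\<exists>Q>0. \<forall>k>k2. r k \<le>
                 ereal ((Q / (real (k - k2) * (1 - 2 * \<theta>))) powr (1 / (1 - 2 * \<theta>))))))"
proof -
  \<comment> \<open>At \<open>k = 0\<close> truncated subtraction gives \<open>zh 0 = z 0\<close>,
    as the convention for the index -1 demands.\<close>
  define zh where "zh k = z k + \<beta> k *\<^sub>R (z k - z (k - 1))" for k
  have LW: "0 \<le> LW" using LipW by (rule lipschitz_constant_nonneg)
  have LH: "0 \<le> LH" using LipH by (rule lipschitz_constant_nonneg)
  have cs_pos: "0 < cs k" and ds_pos: "0 < ds k" for k
    using step_c[of k] step_d[of k] LW LH rho0 by linarith+
  have "\<exists>y. (y = z k \<or> y = zh k) \<and>
      is_prox f (cs k) (fst y - (1 / cs k) *\<^sub>R fst (grad y)) (fst (z (Suc k))) \<and>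
      is_prox g (ds k) (snd y - (1 / ds k) *\<^sub>R snd (grad (fst (z (Suc k)), snd y))) (snd (z (Suc k))) \<and>
      Jfun F f g (z (Suc k)) \<le> Jfun F f g (z k) - ereal (\<rho>0 * (norm (z (Suc k) - y))\<^sup>2)" for k
  proof -
    have zh_pair: "(fst (zh k), snd (zh k)) = zh k" by simp
    have zh_comp: "fst (zh k) = fst (z k) + \<beta> k *\<^sub>R (fst (z k) - fst (z (k - 1)))"
      "snd (zh k) = snd (z k) + \<beta> k *\<^sub>R (snd (z k) - snd (z (k - 1)))"
      by (simp_all add: zh_def)
    obtain W' H' where
      pf: "is_prox f (cs k) (fst (zh k) - (1 / cs k) *\<^sub>R fst (grad (zh k))) W'" and
      pg: "is_prox g (ds k) (snd (zh k) - (1 / ds k) *\<^sub>R snd (grad (W', snd (zh k)))) H'" and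
      test: "if Jfun F f g (W', H') \<le> Jfun F f g (z k) - ereal (\<rho>0 * (norm (W' - fst (zh k), H' - snd (zh k)))\<^sup>2)
        then z (Suc k) = (W', H')
        else is_prox f (cs k) (fst (z k) - (1 / cs k) *\<^sub>R fst (grad (z k))) (fst (z (Suc k))) \<and>
             is_prox g (ds k) (snd (z k) - (1 / ds k) *\<^sub>R snd (grad (fst (z (Suc k)), snd (z k)))) (snd (z (Suc k)))"
      using scheme[unfolded accPALM_def Let_def, rule_format, of k]
      unfolding zh_comp[symmetric] zh_pair prod.collapse by blast
    show ?thesis
    proof (cases "Jfun F f g (W', H') \<le> Jfun F f g (z k)
        - ereal (\<rho>0 * (norm (W' - fst (zh k), H' - snd (zh k)))\<^sup>2)")
      case True
      with test have Z: "z (Suc k) = (W', H')" by simp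
      have "z (Suc k) - zh k = (W' - fst (zh k), H' - snd (zh k))"
        by (simp add: Z prod_eq_iff)
      \<comment> \<open>On acceptance, the test itself is the required decrease.\<close>
      with True pf pg show ?thesis by (intro exI[of _ "zh k"]) (simp add: Z)
    next
      case False
      with test have
        pf': "is_prox f (cs k) (fst (z k) - (1 / cs k) *\<^sub>R fst (grad (z k))) (fst (z (Suc k)))" and
        pg': "is_prox g (ds k) (snd (z k) - (1 / ds k) *\<^sub>R snd (grad (fst (z (Suc k)), snd (z k)))) (snd (z (Suc k)))"
        by simp_all
      have "Jfun F f g (fst (z (Suc k)), snd (z (Suc k))) \<le> Jfun F f g (fst (z k), snd (z k))
          - ereal (\<rho>0 * (norm ((fst (z (Suc k)), snd (z (Suc k))) - (fst (z k), snd (z k))))\<^sup>2)"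
        using step_c[of k] step_d[of k] cs_pos[of k] ds_pos[of k] pf' pg'
        by (intro palm_step_descent[OF F_grad LipW LipH, where c = "cs k" and d = "ds k"]) auto
      with pf' pg' show ?thesis by (intro exI[of _ "z k"]) simp
    qed
  qed
  then obtain y where y: "\<And>k. y k = z k \<or> y k = zh k"
    and prox_f: "\<And>k. is_prox f (cs k) (fst (y k) - (1 / cs k) *\<^sub>R fst (grad (y k))) (fst (z (Suc k)))"
    and prox_g: "\<And>k. is_prox g (ds k)
      (snd (y k) - (1 / ds k) *\<^sub>R snd (grad (fst (z (Suc k)), snd (y k)))) (snd (z (Suc k)))"
    and desc: "\<And>k. Jfun F f g (z (Suc k)) \<le> Jfun F f g (z k) - ereal (\<rho>0 * (norm (z (Suc k) - y k))\<^sup>2)"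
    by metis
  obtain B where B: "\<And>k. norm (z k) \<le> B" using z_bdd by (auto simp: bounded_iff)
  \<comment> \<open>As \<open>\<beta> k\<close> is at most 1, extrapolation adds at most the norms
    of two iterates.\<close>
  have "norm (y k) \<le> 3 * B" for k
  proof -
    have "norm (zh k) \<le> norm (z k) + norm (\<beta> k *\<^sub>R (z k - z (k - 1)))"
      unfolding zh_def by (rule norm_triangle_ineq)
    also have "norm (\<beta> k *\<^sub>R (z k - z (k - 1))) \<le> 1 * norm (z k - z (k - 1))"
      using beta[of k] beta_max unfolding norm_scaleR by (intro mult_right_mono) auto
    also have "1 * norm (z k - z (k - 1)) \<le> norm (z k) + norm (z (k - 1))"
      using norm_triangle_ineq4 by simp
    finally have "norm (zh k) \<le> 3 * B" using B[of k] B[of "k - 1"] by linarith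
    moreover have "norm (z k) \<le> 3 * B" using B[of k] norm_ge_zero[of "z k"] by linarith
    ultimately show ?thesis using y[of k] by auto
  qed
  then have y_bdd: "bounded (range y)" by (auto simp: bounded_iff)
  interpret palm_sequence F grad f g \<rho>0 cbar dbar cs ds z y
    by (intro palm_sequence.intro f_proper f_lsc g_proper g_lsc J_bdd F_grad grad_lip_bdd rho0 init
        prox_f prox_g desc z_bdd y_bdd conjI cs_pos ds_pos conjunct2[OF step_c] conjunct2[OF step_d])
  show ?thesis by (rule convergence_rates[OF J_const KL theta(1) cKL])
qed

end
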